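(* Let $d \geq 2$ be an integer and $\lambda \in \mathbb{C}$, and let $f(z) = \frac{\lambda}{(1+z)^d}$. Assume there is a curve $\{h(t) : t \in [a,b]\}$, where $a<b$ are real numbers, such that (1) $h(t) = 0$ for some $t \in [a,b]$; (2) $\arg(1+h(t))$ is strictly increasing for $t \in [a,b)$; (3) for any $t_1, t_2 \in [a,b]$ and $\alpha \in [0,1]$, the point $\alpha h(t_1) + (1-\alpha) h(t_2)$ is $-1$-covered by $h(t)$ for some $t \in [t_1,t_2]$; (4) for every $t \in [a,b]$, $f(h(t))$ is $-1$-covered by $h(t')$ for some $t' \in [a,b]$. Then $Z_G(\lambda) \neq 0$ for every graph $G \in \mathcal{G}_{d+1}$.
   Context: For a finite graph $G$, $Z_G(\lambda) = \sum_{I} \lambda^{|I|}$, the sum over all independent sets $I$ of $G$ (including the empty set). $\mathcal{G}_{d+1}$ is the set of finite graphs with maximum degree at most $d+1$. For $z = \rho e^{\iota\vartheta}$, $\rho>0$, $\vartheta\in(-\pi,\pi]$, $\arg z = \vartheta$. A point $z \in \mathbb{C}$ is $-1$-covered by $z' \in \mathbb{C}$ if $\arg(1+z) = \arg(1+z')$ and $|1+z| \geq |1+z'|$. *)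

theory Defs
  imports "HOL-Analysis.Analysis" "Graph_Theory.Digraph"
begin

text \<open>
  Finite simple graphs are the symmetric digraphs of the locale \<^locale>\<open>graph\<close>: an undirected edge
  is a pair of opposite arcs, so the degree of a vertex is its out-degree.
\<close>

definition graphs_max_degree :: "nat \<Rightarrow> ('a, 'b) pre_digraph set" where
  "graphs_max_degree k = {G. graph G \<and> (\<forall>v \<in> verts G. out_degree G v \<le> k)}"

definition independent_sets :: "('a, 'b) pre_digraph \<Rightarrow> 'a set set" where
  "independent_sets G = {I. I \<subseteq> verts G \<and> (\<forall>u \<in> I. \<forall>v \<in> I. \<not> u \<rightarrow>\<^bsub>G\<^esub> v)}"

definition independence_poly :: "('a, 'b) pre_digraph \<Rightarrow> complex \<Rightarrow> complex" where
  "independence_poly G x = (\<Sum>I \<in> independent_sets G. x ^ card I)"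

text \<open>
  The argument of a complex number is defined for nonzero numbers only, whereas \<^term>\<open>Arg 0 = 0\<close>;
  hence the two conditions that exclude the point $-1$.
\<close>

definition minus_one_covered :: "complex \<Rightarrow> complex \<Rightarrow> bool" where
  "minus_one_covered z z' \<longleftrightarrow> 1 + z \<noteq> 0 \<and> 1 + z' \<noteq> 0 \<and>
     Arg (1 + z) = Arg (1 + z') \<and> cmod (1 + z) \<ge> cmod (1 + z')"

end

theory Submission
  imports Defs
begin

text \<open>
  Deleting a vertex \<open>v\<close> gives \<open>Z(S) = Z(S - v) (1 + R)\<close> for the occupation ratio \<open>R\<close> of \<open>v\<close>, and
  \<open>R = \<lambda> / (1 + R\<^sub>1) \<dots> (1 + R\<^sub>k)\<close> with ratios \<open>R\<^sub>i\<close> of the neighbours of \<open>v\<close>, each of which has lost a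
  neighbour. So it suffices that the region covered by the curve is stable under this recursion for
  \<open>k \<le> d\<close>, and that \<open>R \<noteq> -1\<close> for \<open>k = d + 1\<close>. The chord condition makes the inverse distance
  to \<open>-1\<close> a concave function of the angle along the curve. By Jensen's inequality and AM-GM, a recursion
  step with \<open>d\<close> inputs then yields a point \<open>s f(h(t))\<close> with \<open>0 \<le> s \<le> 1\<close>, and such points remain in the
  region since the curve passes through \<open>0\<close>.
\<close>

section \<open>The region covered by the curve\<close>

text \<open>Concavity of the sine on [0, pi], applied between 0 and s. It will bound the weights of
  a chord point from below.\<close>

lemma sin_mult_ge:
  fixes s u :: real
  assumes "0 \<le> s" "s \<le> pi" "0 \<le> u" "u \<le> 1"
  shows "u * sin s \<le> sin (u * s)"
proof -
  have "convex_on {0..pi} (\<lambda>x. - sin x)"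
    by (rule f''_ge0_imp_convex[where f' = "\<lambda>x. - cos x" and f'' = sin])
      (auto intro!: derivative_eq_intros sin_ge_zero)
  then have "concave_on {0..pi} sin"
    by (simp add: concave_on_def)
  from concave_onD[OF this, of u 0 s] assms show ?thesis
    by simp
qed

lemma prod_list_prod_nth:
  fixes xs :: "'a::comm_monoid_mult list"
  shows "prod_list xs = (\<Prod>i<length xs. xs ! i)"
  by (induction xs) (simp_all add: prod.lessThan_Suc_shift del: prod.lessThan_Suc)

lemma powr_inverse_power:
  fixes y :: real
  assumes "y > 0" "n > 0"
  shows "(y powr (1 / real n)) ^ n = y"
  using powr_realpow[of "y powr (1 / real n)" n] assms by (simp add: powr_powr)

text \<open>Cramer's rule for the direction \<open>cis s\<close> in terms of \<open>cis p\<close>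
  and \<open>cis q\<close>, with the determinants written as sines of angle differences.\<close>

lemma sin_diff_cis:
  "of_real (sin (q - p)) * cis s = of_real (sin (q - s)) * cis p + of_real (sin (s - p)) * cis q"
  by (rule complex_eqI)
    (use sin_cos_squared_add[of p] sin_cos_squared_add[of q] sin_cos_squared_add[of s]
      in \<open>simp_all add: sin_diff, algebra+\<close>)

section \<open>The curve in polar coordinates around -1\<close>

locale covering_curve =
  fixes h :: "real \<Rightarrow> complex" and a b :: real
  assumes ab: "a < b"
    and cont: "continuous_on {a..b} h"
    and zero_on: "\<exists>t \<in> {a..b}. h t = 0"
    and mono: "strict_mono_on {a..<b} (\<lambda>t. Arg (1 + h t))"
    and chord: "\<And>t1 t2 \<alpha>. t1 \<in> {a..b} \<Longrightarrow> t2 \<in> {a..b} \<Longrightarrow> t1 \<le> t2 \<Longrightarrow> \<alpha> \<in> {0..1} \<Longrightarrow>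
           \<exists>t \<in> {t1..t2}. minus_one_covered (of_real \<alpha> * h t1 + of_real (1 - \<alpha>) * h t2) (h t)"
begin

text \<open>Moves the centre -1 to the origin, so that covering compares points on a common ray from
  0.\<close>

definition w :: "real \<Rightarrow> complex" where "w t = 1 + h t"

definition \<theta> :: "real \<Rightarrow> real" where "\<theta> t = Arg (w t)"

text \<open>Seen from -1, this is the union of the outward rays that start at the points of the
  curve.\<close>

definition region :: "complex set" where
  "region = {z. \<exists>t \<in> {a..b}. minus_one_covered z (h t)}"

lemma chord_w:
  assumes "t1 \<in> {a..b}" "t2 \<in> {a..b}" "t1 \<le> t2" "\<alpha> \<in> {0..1}"
  obtains t where "t \<in> {t1..t2}" "of_real \<alpha> * w t1 + of_real (1 - \<alpha>) * w t2 \<noteq> 0"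
    "Arg (of_real \<alpha> * w t1 + of_real (1 - \<alpha>) * w t2) = \<theta> t"
    "cmod (w t) \<le> cmod (of_real \<alpha> * w t1 + of_real (1 - \<alpha>) * w t2)"
proof -
  have "1 + (of_real \<alpha> * h t1 + of_real (1 - \<alpha>) * h t2) = of_real \<alpha> * w t1 + of_real (1 - \<alpha>) * w t2"
    by (simp add: w_def algebra_simps)
  then show ?thesis
    using chord[OF assms] that unfolding minus_one_covered_def \<theta>_def w_def by metis
qed

text \<open>The degenerate chord from t to t must be covered, and covering excludes -1.\<close>

lemma w_nonzero: "t \<in> {a..b} \<Longrightarrow> w t \<noteq> 0"
  using chord_w[of t t 1] by auto

lemma w_polar: "t \<in> {a..b} \<Longrightarrow> w t = of_real (cmod (w t)) * cis (\<theta> t)"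
  unfolding \<theta>_def using rcis_cmod_Arg[of "w t"] by (simp add: rcis_def)

lemma \<theta>_bounds: "- pi < \<theta> t" "\<theta> t \<le> pi"
  using Arg_bounded[of "w t"] by (auto simp: \<theta>_def)

lemma strict_mono_\<theta>_left:
  assumes "s \<in> {a..<b}" "t \<in> {a..<b}" "s < t"
  shows "\<theta> s < \<theta> t"
  using strict_mono_onD[OF mono assms(1,2,3)] by (simp add: \<theta>_def w_def)

text \<open>A strictly larger angle, itself at most pi, still occurs between t and b.\<close>

lemma \<theta>_less_pi:
  assumes "t \<in> {a..<b}"
  shows "\<theta> t < pi"
  using strict_mono_\<theta>_left[of t "(t + b) / 2"] assms \<theta>_bounds(2)[of "(t + b) / 2"] by auto

lemma continuous_on_w: "continuous_on {a..b} w"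
  unfolding w_def by (intro continuous_intros cont)

text \<open>
  If the curve ends on the cut of \<^const>\<open>Arg\<close>, then \<^term>\<open>\<theta>\<close> stays away from \<open>-\<pi>\<close>, because it
  increases, so a small rotation moves the whole curve off the cut.
\<close>

lemma continuous_on_\<theta>: "continuous_on {a..b} \<theta>"
proof (cases "\<theta> b = pi")
  case False
  \<comment> \<open>On the cut the angle is pi, which is impossible before b by monotonicity and at
    b by the case assumption.\<close>
  have "w t \<notin> \<real>\<^sub>\<le>\<^sub>0" if "t \<in> {a..b}" for t
  proof
    assume "w t \<in> \<real>\<^sub>\<le>\<^sub>0"
    then have "\<theta> t = pi"
      using w_nonzero[OF that]
      by (auto simp: \<theta>_def Arg_eq_pi complex_nonpos_Reals_iff complex_eq_iff less_le)
    then show False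
      using that False \<theta>_less_pi[of t] by (cases "t = b") auto
  qed
  then show ?thesis
    unfolding \<theta>_def by (intro continuous_on_Arg' continuous_on_w) auto
next
  case True
  \<comment> \<open>The midpoint of the angle range from \<open>\<theta> a\<close> to pi: rotating
    by -p centres this range at 0, with half-width below pi.\<close>
  define p where "p = (\<theta> a + pi) / 2"
  have p: "0 < p" "p < pi"
    using \<theta>_bounds[of a] \<theta>_less_pi[of a] ab by (auto simp: p_def)
  have range: "- pi < \<theta> t - p" "\<theta> t - p < pi" if "t \<in> {a..b}" for t
  proof -
    have "\<theta> a \<le> \<theta> t"
      using that ab strict_mono_\<theta>_left[of a t] True \<theta>_bounds(2)[of a]
      by (cases "t = b"; cases "t = a") auto
    then show "- pi < \<theta> t - p"
      using \<theta>_bounds(1)[of a] p by (simp add: p_def field_simps)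
    show "\<theta> t - p < pi"
      using \<theta>_bounds(2)[of t] p by simp
  qed
  have Arg_rot: "Arg (w t * cis (- p)) = \<theta> t - p" if "t \<in> {a..b}" for t
  proof (rule Arg_unique')
    show "0 < cmod (w t)" using w_nonzero[OF that] by simp
    show "\<theta> t - p \<in> {- pi<..pi}" using range[OF that] by simp
    show "w t * cis (- p) = rcis (cmod (w t)) (\<theta> t - p)"
      by (subst w_polar[OF that]) (simp add: rcis_def cis_mult)
  qed
  have "continuous_on {a..b} (\<lambda>t. Arg (w t * cis (- p)))"
  proof (intro continuous_on_Arg' continuous_intros continuous_on_w)
    fix t assume t: "t \<in> {a..b}"
    show "w t * cis (- p) \<notin> \<real>\<^sub>\<le>\<^sub>0"
    proof
      assume "w t * cis (- p) \<in> \<real>\<^sub>\<le>\<^sub>0"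
      moreover have "w t * cis (- p) \<noteq> 0"
        using w_nonzero[OF t] by simp
      ultimately have "Arg (w t * cis (- p)) = pi"
        by (auto simp: Arg_eq_pi complex_nonpos_Reals_iff complex_eq_iff less_le simp del: mult_eq_0_iff)
      then show False
        using Arg_rot[OF t] range(2)[OF t] by simp
    qed
  qed
  then have "continuous_on {a..b} (\<lambda>t. Arg (w t * cis (- p)) + p)"
    by (intro continuous_on_add continuous_on_const)
  then show ?thesis
    by (rule continuous_on_eq) (simp add: Arg_rot)
qed

text \<open>Continuity extends monotonicity to the endpoint b. Strictness survives the limit because
  the midpoint m separates s from b:
  \<open>\<theta> s < \<theta> m \<le> \<theta> b\<close>.\<close>

lemma \<theta>_less:
  assumes "s \<in> {a..b}" "t \<in> {a..b}" "s < t"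
  shows "\<theta> s < \<theta> t"
proof (cases "t < b")
  case True
  then show ?thesis using assms strict_mono_\<theta>_left by simp
next
  case False
  then have t: "t = b" using assms by simp
  define m where "m = (s + b) / 2"
  have m: "s < m" "m < b" "m \<in> {a..<b}" using assms t by (auto simp: m_def)
  have "(\<theta> \<longlongrightarrow> \<theta> b) (at b within {a..b})"
    using continuous_on_\<theta> ab by (auto simp: continuous_on_def)
  then have "(\<theta> \<longlongrightarrow> \<theta> b) (at_left b)"
    using ab by (simp add: at_within_Icc_at_left)
  moreover have "\<forall>\<^sub>F u in at_left b. \<theta> m \<le> \<theta> u"
    unfolding eventually_at_left[OF m(2)]
    using m by (intro exI[of _ m]) (auto intro!: less_imp_le strict_mono_\<theta>_left)
  ultimately have "\<theta> m \<le> \<theta> b"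
    by (intro tendsto_lowerbound) auto
  moreover have "\<theta> s < \<theta> m"
    using m assms by (intro strict_mono_\<theta>_left) auto
  ultimately show ?thesis using t by simp
qed

lemma \<theta>_le: "s \<in> {a..b} \<Longrightarrow> t \<in> {a..b} \<Longrightarrow> s \<le> t \<Longrightarrow> \<theta> s \<le> \<theta> t"
  using \<theta>_less[of s t] by (cases "s = t") auto

lemma \<theta>_inj: "s \<in> {a..b} \<Longrightarrow> t \<in> {a..b} \<Longrightarrow> \<theta> s = \<theta> t \<Longrightarrow> s = t"
  using \<theta>_less[of s t] \<theta>_less[of t s] by (cases s t rule: linorder_cases) auto

lemma \<theta>_surj:
  assumes "s \<in> {a..b}" "t \<in> {a..b}" "s \<le> t" "\<theta> s \<le> y" "y \<le> \<theta> t"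
  obtains u where "u \<in> {s..t}" "\<theta> u = y"
proof -
  have "continuous_on {s..t} \<theta>"
    using assms by (intro continuous_on_subset[OF continuous_on_\<theta>]) auto
  from IVT'[OF assms(4,5,3) this] that show ?thesis by auto
qed

text \<open>Otherwise the chord between two points of the curve seen at angle \<open>\<pi>\<close> from \<open>-1\<close> would pass
  through \<open>-1\<close>.\<close>

lemma \<theta>_diff_less_pi:
  assumes "s \<in> {a..b}" "t \<in> {a..b}" "s \<le> t"
  shows "\<theta> t - \<theta> s < pi"
proof (rule ccontr)
  assume "\<not> \<theta> t - \<theta> s < pi"
  then obtain u where u: "u \<in> {s..t}" "\<theta> u = \<theta> s + pi"
    using \<theta>_surj[OF assms, of "\<theta> s + pi"] by auto
  then have ub: "u \<in> {a..b}" "s \<le> u" using assms by auto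
  define r q where "r = cmod (w s)" and "q = cmod (w u)"
  have pos: "r > 0" "q > 0" using w_nonzero assms ub by (auto simp: r_def q_def)
  have ws: "w s = of_real r * cis (\<theta> s)" and wu: "w u = - of_real q * cis (\<theta> s)"
    using w_polar[OF assms(1)] w_polar[OF ub(1)] by (simp_all add: r_def q_def u flip: cis_mult)
  \<comment> \<open>The weights q / (r + q) and r / (r + q) make two opposite vectors of lengths r
    and q cancel.\<close>
  have "q / (r + q) \<in> {0..1}" using pos by simp
  moreover have "of_real (q / (r + q)) * w s + of_real (1 - q / (r + q)) * w u = 0"
  proof -
    have eq: "1 - q / (r + q) = r / (r + q)" using pos by (simp add: field_simps)
    have "complex_of_real (r + q) \<noteq> 0" using pos by (simp only: of_real_eq_0_iff)
    then show ?thesis unfolding eq ws wu by (simp add: field_simps)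
  qed
  ultimately show False
    using chord_w[OF assms(1) ub, of "q / (r + q)"] by metis
qed

text \<open>In polar coordinates around \<open>-1\<close>, a line has \<open>1 / r\<close> proportional to the cosine of a shifted
  angle; so curves lying below their chords have concave \<open>1 / r\<close>, as the cosine is concave.\<close>

lemma inverse_radius_two_point:
  assumes s: "s \<in> {a..b}" "t \<in> {a..b}" "m \<in> {a..b}" and "s < t"
    and u: "0 \<le> u" "u \<le> 1" and m: "\<theta> m = (1 - u) * \<theta> s + u * \<theta> t"
  shows "(1 - u) / cmod (w s) + u / cmod (w t) \<le> 1 / cmod (w m)"
proof -
  define D where "D = \<theta> t - \<theta> s"
  have D: "0 < D" "D < pi"
    using \<theta>_less[OF s(1,2)] \<theta>_diff_less_pi[OF s(1,2)] \<open>s < t\<close> by (auto simp: D_def)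
  then have sinD: "sin D > 0" by (rule sin_gt_zero)
  define A B where "A = sin ((1 - u) * D) / sin D" and "B = sin (u * D) / sin D"
  have AB: "1 - u \<le> A" "u \<le> B"
    using sin_mult_ge[of D "1 - u"] sin_mult_ge[of D u] D u sinD
    by (auto simp: A_def B_def field_simps)
  have angles: "\<theta> t - \<theta> m = (1 - u) * D" "\<theta> m - \<theta> s = u * D"
    by (simp_all add: m D_def algebra_simps)
  have comb: "cis (\<theta> m) = of_real A * cis (\<theta> s) + of_real B * cis (\<theta> t)"
  proof -
    have "of_real (sin D) * cis (\<theta> m)
        = of_real (sin D) * (of_real A * cis (\<theta> s) + of_real B * cis (\<theta> t))"
      using sin_diff_cis[of "\<theta> t" "\<theta> s" "\<theta> m"] sinD
      by (simp add: angles A_def B_def flip: D_def) (simp add: field_simps)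
    then show ?thesis using sinD by simp
  qed
  define r q where "r = cmod (w s)" and "q = cmod (w t)"
  have pos: "r > 0" "q > 0" using w_nonzero s by (auto simp: r_def q_def)
  \<comment> \<open>The chord meets the ray of angle \<open>\<theta> m\<close> at distance 1 / R
    from the origin; the weights A and B dominate 1 - u and u by concavity of the sine.\<close>
  define R where "R = A / r + B / q"
  have R: "(1 - u) / r + u / q \<le> R"
    unfolding R_def using AB pos by (intro add_mono divide_right_mono) auto
  have "0 < (1 - u) / r + u / q"
    using u pos by (cases "u = 0") (auto intro!: add_nonneg_pos)
  with R have Rpos: "R > 0" by linarith
  define \<alpha> where "\<alpha> = A / r / R"
  have \<alpha>: "\<alpha> \<in> {0..1}" "1 - \<alpha> = B / q / R"
    using AB u pos Rpos by (auto simp: \<alpha>_def R_def field_simps)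
  have eq: "of_real \<alpha> * w s + of_real (1 - \<alpha>) * w t = of_real (1 / R) * cis (\<theta> m)"
  proof -
    have "w s = of_real r * cis (\<theta> s)" "w t = of_real q * cis (\<theta> t)"
      using w_polar s by (auto simp: r_def q_def)
    then show ?thesis
      unfolding comb \<alpha>(2) using pos Rpos by (simp add: \<alpha>_def field_simps)
  qed
  have "Arg (of_real (1 / R) * cis (\<theta> m)) = \<theta> m"
    using Rpos \<theta>_bounds[of m] by (intro Arg_unique'[of "1 / R"]) (auto simp: rcis_def)
  then obtain m' where m': "m' \<in> {s..t}" "\<theta> m = \<theta> m'" "cmod (w m') \<le> cmod (of_real (1 / R) * cis (\<theta> m))"
    using chord_w[OF s(1,2) _ \<alpha>(1)] \<open>s < t\<close> unfolding eq by (metis less_imp_le)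
  \<comment> \<open>Injectivity of the angle identifies the covering point with m, so the curve is
    no farther out than the chord.\<close>
  then have "m' = m" using s by (auto intro: \<theta>_inj[of m' m])
  then have "cmod (w m) \<le> 1 / R" using m'(3) Rpos by (simp add: norm_mult norm_divide)
  then have "R \<le> 1 / cmod (w m)"
    using Rpos w_nonzero[OF s(3)] by (simp add: field_simps)
  with R show ?thesis by (simp add: r_def q_def)
qed

section \<open>Jensen's inequality in the angle parameter\<close>

text \<open>Parametrises the curve by its angle, which turns the inverse radius into a function on
  an interval.\<close>

definition \<tau> :: "real \<Rightarrow> real" where "\<tau> = inv_into {a..b} \<theta>"

lemma \<tau>:
  assumes "y \<in> {\<theta> a..\<theta> b}"
  shows "\<tau> y \<in> {a..b}" "\<theta> (\<tau> y) = y"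
proof -
  have "y \<in> \<theta> ` {a..b}"
    using \<theta>_surj[of a b y] assms ab by force
  then show "\<tau> y \<in> {a..b}" "\<theta> (\<tau> y) = y"
    unfolding \<tau>_def by (rule inv_into_into, rule f_inv_into_f)
qed

lemma \<tau>_\<theta>: "t \<in> {a..b} \<Longrightarrow> \<tau> (\<theta> t) = t"
  unfolding \<tau>_def by (rule inv_into_f_f[OF inj_onI[OF \<theta>_inj]])

lemma concave_inverse_radius: "concave_on {\<theta> a..\<theta> b} (\<lambda>y. 1 / cmod (w (\<tau> y)))"
proof (rule concave_on_linorderI)
  fix u x y :: real
  assume u: "0 < u" "u < 1" and xy: "x \<in> {\<theta> a..\<theta> b}" "y \<in> {\<theta> a..\<theta> b}" "x < y"
  let ?m = "(1 - u) *\<^sub>R x + u *\<^sub>R y"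
  have "?m \<in> {\<theta> a..\<theta> b}"
    using convexD_alt[OF convex_real_interval(5), of x _ _ y u] xy u by auto
  note m = \<tau>[OF this] and x = \<tau>[OF xy(1)] and y = \<tau>[OF xy(2)]
  have "\<tau> x < \<tau> y"
    using \<theta>_le[OF y(1) x(1)] x y xy(3) by (cases "\<tau> x < \<tau> y") auto
  from inverse_radius_two_point[OF x(1) y(1) m(1) this, of u] u m x y
  show "(1 - u) * (1 / cmod (w (\<tau> x))) + u * (1 / cmod (w (\<tau> y))) \<le> 1 / cmod (w (\<tau> ?m))"
    by simp
qed simp

text \<open>Take s at the mean angle. The geometric mean of the inverse radii is at most their
  arithmetic mean, which by Jensen is at most the inverse radius at s. So d points of the curve can
  be traded for d copies of one point.\<close>

lemma prod_radius_ge: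
  fixes t :: "nat \<Rightarrow> real"
  assumes "d > 0" "\<And>i. i < d \<Longrightarrow> t i \<in> {a..b}"
  obtains s where "s \<in> {a..b}" "real d * \<theta> s = (\<Sum>i<d. \<theta> (t i))"
    "cmod (w s) ^ d \<le> (\<Prod>i<d. cmod (w (t i)))"
proof -
  have ne: "{..<d} \<noteq> {}" "finite {..<d}" using \<open>d > 0\<close> by auto
  have in_range: "\<theta> (t i) \<in> {\<theta> a..\<theta> b}" if "i < d" for i
    using assms(2)[OF that] \<theta>_le[of a "t i"] \<theta>_le[of "t i" b] ab by auto
  define y where "y = (\<Sum>i<d. (1 / real d) *\<^sub>R \<theta> (t i))"
  have y: "y \<in> {\<theta> a..\<theta> b}"
    unfolding y_def using in_range \<open>d > 0\<close> by (intro convex_sum) auto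
  note s = \<tau>[OF y]
  have "(\<Sum>i<d. 1 / real d * (1 / cmod (w (\<tau> (\<theta> (t i)))))) \<le> 1 / cmod (w (\<tau> y))"
    unfolding y_def using in_range \<open>d > 0\<close>
    by (intro concave_on_sum[OF ne(2,1) concave_inverse_radius]) auto
  then have "(\<Sum>i<d. 1 / cmod (w (t i)) / card {..<d}) \<le> 1 / cmod (w (\<tau> y))"
    using assms(2) by (simp add: \<tau>_\<theta> mult.commute)
  moreover have "(\<Prod>i<d. 1 / cmod (w (t i))) powr (1 / card {..<d}) \<le> (\<Sum>i<d. 1 / cmod (w (t i)) / card {..<d})"
    using ne by (intro arith_geom_mean) auto
  ultimately have le: "(\<Prod>i<d. 1 / cmod (w (t i))) powr (1 / real d) \<le> 1 / cmod (w (\<tau> y))"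
    by simp
  have pos: "cmod (w (t i)) > 0" if "i < d" for i
    using w_nonzero assms(2)[OF that] by auto
  have P: "(\<Prod>i<d. 1 / cmod (w (t i))) > 0"
    using pos by (intro prod_pos) auto
  have "(\<Prod>i<d. 1 / cmod (w (t i))) = ((\<Prod>i<d. 1 / cmod (w (t i))) powr (1 / real d)) ^ d"
    by (rule powr_inverse_power[OF P \<open>d > 0\<close>, symmetric])
  also have "\<dots> \<le> (1 / cmod (w (\<tau> y))) ^ d"
    using le by (intro power_mono) auto
  finally have "1 / (\<Prod>i<d. cmod (w (t i))) \<le> 1 / cmod (w (\<tau> y)) ^ d"
    by (simp add: prod_dividef power_one_over)
  moreover have "(\<Prod>i<d. cmod (w (t i))) > 0" using pos by (intro prod_pos) auto
  moreover have "cmod (w (\<tau> y)) ^ d > 0" using w_nonzero[OF s(1)] by simp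
  ultimately have "cmod (w (\<tau> y)) ^ d \<le> (\<Prod>i<d. cmod (w (t i)))"
    by (simp add: field_simps)
  moreover have "real d * \<theta> (\<tau> y) = (\<Sum>i<d. \<theta> (t i))"
    using s(2) \<open>d > 0\<close> by (simp add: y_def flip: sum_divide_distrib)
  ultimately show ?thesis using that s(1) by blast
qed

section \<open>Covered points as combinations of curve points\<close>

lemma regionE:
  assumes "z \<in> region"
  obtains t c where "t \<in> {a..b}" "c \<ge> 1" "1 + z = of_real c * w t"
proof -
  obtain t where t: "t \<in> {a..b}" "1 + z \<noteq> 0" "Arg (1 + z) = \<theta> t" "cmod (w t) \<le> cmod (1 + z)"
    using assms by (auto simp: region_def minus_one_covered_def \<theta>_def w_def)
  have "1 + z = of_real (cmod (1 + z)) * cis (\<theta> t)"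
    using rcis_cmod_Arg[of "1 + z"] t(3) by (simp add: rcis_def)
  also have "\<dots> = of_real (cmod (1 + z) / cmod (w t)) * (of_real (cmod (w t)) * cis (\<theta> t))"
    using w_nonzero[OF t(1)] by simp
  finally have "1 + z = of_real (cmod (1 + z) / cmod (w t)) * w t"
    using w_polar[OF t(1)] by simp
  moreover have "cmod (1 + z) / cmod (w t) \<ge> 1"
    using t w_nonzero[OF t(1)] by (simp add: field_simps)
  ultimately show ?thesis using that t(1) by blast
qed

text \<open>Dividing by p + q gives a point of a chord, and scaling back by a positive real keeps
  the argument.\<close>

lemma cone_w:
  assumes "t1 \<in> {a..b}" "t2 \<in> {a..b}" "p \<ge> 0" "q \<ge> 0" "p + q > 0"
  obtains t where "t \<in> {a..b}" "of_real p * w t1 + of_real q * w t2 \<noteq> 0"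
    "Arg (of_real p * w t1 + of_real q * w t2) = \<theta> t"
    "(p + q) * cmod (w t) \<le> cmod (of_real p * w t1 + of_real q * w t2)"
proof -
  \<comment> \<open>Stated for fresh points and weights, so that the unordered case follows by
    swapping them.\<close>
  have main: "\<exists>t \<in> {a..b}. of_real p * w t1 + of_real q * w t2 \<noteq> 0 \<and>
    Arg (of_real p * w t1 + of_real q * w t2) = \<theta> t \<and>
    (p + q) * cmod (w t) \<le> cmod (of_real p * w t1 + of_real q * w t2)"
    if hyps: "t1 \<le> t2" "t1 \<in> {a..b}" "t2 \<in> {a..b}" "p \<ge> 0" "q \<ge> 0" "p + q > 0" for t1 t2 p q
  proof -
    define \<alpha> where "\<alpha> = p / (p + q)"
    have \<alpha>: "\<alpha> \<in> {0..1}" using that by (auto simp: \<alpha>_def field_simps)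
    have "p = (p + q) * \<alpha>" "q = (p + q) * (1 - \<alpha>)"
      using that by (auto simp: \<alpha>_def field_simps)
    then have "of_real p * w t1 + of_real q * w t2
        = of_real ((p + q) * \<alpha>) * w t1 + of_real ((p + q) * (1 - \<alpha>)) * w t2"
      by presburger
    also have "\<dots> = of_real (p + q) * (of_real \<alpha> * w t1 + of_real (1 - \<alpha>) * w t2)"
      by (simp add: algebra_simps)
    finally have eq: "of_real p * w t1 + of_real q * w t2
        = of_real (p + q) * (of_real \<alpha> * w t1 + of_real (1 - \<alpha>) * w t2)" .
    obtain t where t: "t \<in> {t1..t2}" "of_real \<alpha> * w t1 + of_real (1 - \<alpha>) * w t2 \<noteq> 0"
      "Arg (of_real \<alpha> * w t1 + of_real (1 - \<alpha>) * w t2) = \<theta> t"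
      "cmod (w t) \<le> cmod (of_real \<alpha> * w t1 + of_real (1 - \<alpha>) * w t2)"
      using chord_w[OF hyps(2,3,1) \<alpha>] by metis
    have "complex_of_real (p + q) \<noteq> 0" using that by (simp only: of_real_eq_0_iff)
    moreover have "t \<in> {a..b}" using t(1) that by auto
    ultimately show ?thesis
      unfolding eq using t that
      by (intro bexI[of _ t]) (auto simp: norm_mult Arg_times_of_real simp del: of_real_add of_real_diff)
  qed
  show ?thesis
  proof (cases "t1 \<le> t2")
    case True
    then show ?thesis using main[of t1 t2 p q] assms that by blast
  next
    case False
    then show ?thesis using main[of t2 t1 q p] assms that by (auto simp: add.commute)
  qed
qed

text \<open>Total weight at least 1 can only push a chord point outwards along its ray.\<close>

lemma cone_region:
  assumes "t1 \<in> {a..b}" "t2 \<in> {a..b}" "p \<ge> 0" "q \<ge> 0" "p + q \<ge> 1"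
    and "1 + z = of_real p * w t1 + of_real q * w t2"
  shows "z \<in> region"
proof -
  obtain t where t: "t \<in> {a..b}" "1 + z \<noteq> 0" "Arg (1 + z) = \<theta> t" "(p + q) * cmod (w t) \<le> cmod (1 + z)"
    using cone_w[OF assms(1-4)] assms(5,6) by (metis less_le_trans zero_less_one)
  have "cmod (w t) \<le> (p + q) * cmod (w t)"
    using mult_right_mono[OF assms(5), of "cmod (w t)"] by simp
  then have "cmod (w t) \<le> cmod (1 + z)"
    using t(4) by linarith
  then show ?thesis
    using t w_nonzero[OF t(1)]
    by (auto simp: region_def minus_one_covered_def \<theta>_def w_def intro!: bexI[of _ t])
qed

lemma zero_in_region: "0 \<in> region"
  using zero_on by (force simp: region_def minus_one_covered_def)

text \<open>Since \<open>w t0 = 1\<close> where the curve passes through 0, \<open>1 + s * z\<close>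
  is the combination of \<open>w t\<close> and \<open>w t0\<close> with weights s * c and 1 - s,
  whose sum is at least 1 as c is.\<close>

lemma region_shrink:
  assumes "z \<in> region" "0 \<le> s" "s \<le> 1"
  shows "of_real s * z \<in> region"
proof -
  obtain t c where t: "t \<in> {a..b}" "c \<ge> 1" "1 + z = of_real c * w t"
    using assms(1) by (rule regionE)
  obtain t0 where t0: "t0 \<in> {a..b}" "h t0 = 0" using zero_on by blast
  have z: "z = of_real c * w t - 1" using t(3) by (simp add: algebra_simps)
  have "s * c \<ge> s * 1" using t(2) assms(2) by (intro mult_left_mono) auto
  then show ?thesis
    using t t0 assms
    by (intro cone_region[of t t0 "s * c" "1 - s"]) (auto simp: z w_def algebra_simps)
qed

text \<open>By the chord condition, \<open>(1 + y) + (1 + z)\<close> is at least \<open>2\<close> whenever it is a positive real,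
  because the only point of the curve with \<open>\<theta> = 0\<close> is \<open>0\<close>.\<close>

lemma region_sum_nonzero:
  assumes "y \<in> region" "z \<in> region"
  shows "1 + y + z \<noteq> 0"
proof
  assume sum: "1 + y + z = 0"
  obtain s p where s: "s \<in> {a..b}" "p \<ge> 1" "1 + y = of_real p * w s"
    using assms(1) by (rule regionE)
  obtain t q where t: "t \<in> {a..b}" "q \<ge> 1" "1 + z = of_real q * w t"
    using assms(2) by (rule regionE)
  obtain t0 where t0: "t0 \<in> {a..b}" "h t0 = 0" using zero_on by blast
  have "of_real p * w s + of_real q * w t = (1 + y) + (1 + z)"
    using s t by simp
  also have "\<dots> = 1"
    using sum by (simp add: algebra_simps)
  finally have one: "of_real p * w s + of_real q * w t = 1" .
  have pq: "p \<ge> 0" "q \<ge> 0" "p + q > 0"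
    using s(2) t(2) by auto
  obtain u where u: "u \<in> {a..b}" "Arg 1 = \<theta> u" "(p + q) * cmod (w u) \<le> 1"
    using cone_w[OF s(1) t(1) pq, unfolded one norm_one] by blast
  have "u = t0"
    using u t0 by (auto intro: \<theta>_inj[of u t0] simp: \<theta>_def w_def)
  then have "p + q \<le> 1" using u(3) t0(2) by (simp add: w_def)
  then show False using s(2) t(2) by simp
qed

section \<open>Stability of the region under the recursion\<close>

text \<open>Replacing all inputs by the curve point s of mean angle preserves the direction of the
  denominator and does not increase its modulus. The result is therefore a value of the map on the
  curve, shrunk towards 0.\<close>

lemma region_step_eq:
  assumes d: "d > 0"
    and inv: "\<And>t. t \<in> {a..b} \<Longrightarrow> \<exists>t' \<in> {a..b}. minus_one_covered (x / (1 + h t) ^ d) (h t')"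
    and zs: "length zs = d" "set zs \<subseteq> region"
  shows "x / prod_list (map (\<lambda>z. 1 + z) zs) \<in> region"
proof -
  have "\<forall>i. \<exists>t c. i < d \<longrightarrow> t \<in> {a..b} \<and> c \<ge> 1 \<and> 1 + zs ! i = of_real c * w t"
    using zs regionE by (metis nth_mem subsetD)
  then obtain t c where tc: "\<And>i. i < d \<Longrightarrow> t i \<in> {a..b}" "\<And>i. i < d \<Longrightarrow> c i \<ge> (1::real)"
    "\<And>i. i < d \<Longrightarrow> 1 + zs ! i = of_real (c i) * w (t i)"
    by metis
  obtain s where s: "s \<in> {a..b}" "real d * \<theta> s = (\<Sum>i<d. \<theta> (t i))"
    "cmod (w s) ^ d \<le> (\<Prod>i<d. cmod (w (t i)))"
    using prod_radius_ge[of d t] d tc(1) by blast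
  define C where "C = (\<Prod>i<d. c i)"
  define K where "K = (\<Prod>i<d. cmod (w (t i)))"
  have C: "C \<ge> 1" unfolding C_def using tc(2) by (intro prod_ge_1) auto
  have ws: "cmod (w s) > 0" using w_nonzero s(1) by auto
  have K: "K > 0" "cmod (w s) ^ d \<le> K"
    using s(3) zero_less_power[OF ws, of d] by (auto simp: K_def)
  have "prod_list (map (\<lambda>z. 1 + z) zs) = (\<Prod>i<d. of_real (c i) * w (t i))"
    using zs(1) tc(3) by (simp add: prod_list_prod_nth)
  also have "\<dots> = (\<Prod>i<d. of_real (c i) * (of_real (cmod (w (t i))) * cis (\<theta> (t i))))"
    using w_polar tc(1) by (intro prod.cong) auto
  also have "\<dots> = of_real (C * K) * (\<Prod>i<d. cis (\<theta> (t i)))"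
    by (simp add: prod.distrib C_def K_def)
  also have "(\<Prod>i<d. cis (\<theta> (t i))) = cis (\<Sum>i<d. \<theta> (t i))"
    by (simp add: cis_conv_exp exp_sum sum_distrib_left)
  also have "\<dots> = cis (\<theta> s) ^ d"
    by (simp only: Complex.DeMoivre s(2))
  finally have prod: "prod_list (map (\<lambda>z. 1 + z) zs) = of_real (C * K) * cis (\<theta> s) ^ d" .
  \<comment> \<open>The shrinking factor: the modulus of the denominator at s over that of the true
    denominator.\<close>
  define \<sigma> where "\<sigma> = cmod (w s) ^ d / (C * K)"
  have "cmod (w s) ^ d \<le> C * K"
    using K(2) mult_right_mono[OF C, of K] K(1) by linarith
  then have \<sigma>: "0 \<le> \<sigma>" "\<sigma> \<le> 1" using C K(1) by (auto simp: \<sigma>_def)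
  have "w s ^ d = of_real (cmod (w s) ^ d) * cis (\<theta> s) ^ d"
    by (subst w_polar[OF s(1)]) (simp add: power_mult_distrib)
  then have "x / prod_list (map (\<lambda>z. 1 + z) zs) = of_real \<sigma> * (x / w s ^ d)"
    using ws C K unfolding prod \<sigma>_def by (simp add: field_simps)
  moreover have "x / w s ^ d \<in> region"
    using inv[OF s(1)] by (auto simp: region_def w_def)
  ultimately show ?thesis using region_shrink \<sigma> by metis
qed

text \<open>Missing inputs are filled up with 0, which lies in the region and contributes a factor
  1.\<close>

lemma region_step:
  assumes d: "d > 0"
    and inv: "\<And>t. t \<in> {a..b} \<Longrightarrow> \<exists>t' \<in> {a..b}. minus_one_covered (x / (1 + h t) ^ d) (h t')"
    and zs: "length zs \<le> d" "set zs \<subseteq> region"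
  shows "x / prod_list (map (\<lambda>z. 1 + z) zs) \<in> region"
proof -
  have "set (zs @ replicate (d - length zs) 0) \<subseteq> region"
    using zs zero_in_region by auto
  with region_step_eq[OF d inv, of "zs @ replicate (d - length zs) 0"] zs(1) show ?thesis
    by (simp add: map_replicate)
qed

text \<open>Split off one input z and let R be the value from the others, at most d in number. Then
  1 + R / (1 + z) vanishes only if 1 + z + R does. Without inputs, x itself is in the region, which
  omits -1.\<close>

lemma region_root_nonzero:
  assumes d: "d > 0"
    and inv: "\<And>t. t \<in> {a..b} \<Longrightarrow> \<exists>t' \<in> {a..b}. minus_one_covered (x / (1 + h t) ^ d) (h t')"
    and zs: "length zs \<le> d + 1" "set zs \<subseteq> region"
  shows "1 + x / prod_list (map (\<lambda>z. 1 + z) zs) \<noteq> 0"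
proof (cases zs)
  case Nil
  then have "x \<in> region" using region_step[OF d inv, of "[]"] by simp
  then show ?thesis using Nil by (auto simp: region_def minus_one_covered_def)
next
  case (Cons z ys)
  define R where "R = x / prod_list (map (\<lambda>z. 1 + z) ys)"
  have R: "R \<in> region"
    unfolding R_def using zs Cons by (intro region_step[OF d inv]) auto
  have z: "z \<in> region" using zs Cons by simp
  then have "1 + z \<noteq> 0" by (auto simp: region_def minus_one_covered_def)
  moreover have "x / prod_list (map (\<lambda>z. 1 + z) zs) = R / (1 + z)"
    by (simp add: Cons R_def field_simps)
  ultimately show ?thesis
    using region_sum_nonzero[OF z R]
    by (metis add_divide_distrib divide_eq_0_iff divide_self)
qed

end

section \<open>The recursion for occupation ratios\<close>

locale finite_adjacency =
  fixes V :: "'a set" and adj :: "'a \<Rightarrow> 'a \<Rightarrow> bool" and x :: complex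
  assumes finite_V: "finite V"
    and sym: "adj u v \<Longrightarrow> adj v u"
    and irrefl: "\<not> adj v v"
begin

text \<open>The independence polynomial at x of the subgraph induced by S.\<close>

definition Z :: "'a set \<Rightarrow> complex" where
  "Z S = (\<Sum>I | I \<subseteq> S \<and> (\<forall>u\<in>I. \<forall>v\<in>I. \<not> adj u v). x ^ card I)"

definition nbrs :: "'a set \<Rightarrow> 'a \<Rightarrow> 'a set" where
  "nbrs S v = {u \<in> S. adj v u}"

text \<open>For v in S, the total weight of the independent sets containing v over that of those
  avoiding v.\<close>

definition ratio :: "'a set \<Rightarrow> 'a \<Rightarrow> complex" where
  "ratio S v = x * Z (S - {v} - nbrs S v) / Z (S - {v})"

lemma Z_empty: "Z {} = 1"
proof -
  have "{I. I \<subseteq> {} \<and> (\<forall>u\<in>I. \<forall>v\<in>I. \<not> adj u v)} = {{}}" by auto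
  then show ?thesis by (simp add: Z_def)
qed

text \<open>Independent sets are sorted by whether they contain v; those that do arise by adding v
  to an independent set that avoids v and its neighbours.\<close>

lemma Z_rec:
  assumes "S \<subseteq> V" "v \<in> S"
  shows "Z S = Z (S - {v}) + x * Z (S - {v} - nbrs S v)"
proof -
  let ?ind = "\<lambda>T. {I. I \<subseteq> T \<and> (\<forall>u\<in>I. \<forall>v\<in>I. \<not> adj u v)}"
  let ?T = "S - {v} - nbrs S v"
  have fin: "finite S" using assms finite_V finite_subset by blast
  have split: "?ind S = ?ind (S - {v}) \<union> insert v ` ?ind ?T"
  proof (intro equalityI subsetI)
    fix I assume I: "I \<in> ?ind S"
    show "I \<in> ?ind (S - {v}) \<union> insert v ` ?ind ?T"
    proof (cases "v \<in> I")
      case True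
      then have "I = insert v (I - {v})" "I - {v} \<in> ?ind ?T"
        using I by (auto simp: nbrs_def)
      then show ?thesis by blast
    qed (use I in auto)
  next
    fix I assume "I \<in> ?ind (S - {v}) \<union> insert v ` ?ind ?T"
    then show "I \<in> ?ind S"
      using assms(2) by (auto simp: nbrs_def irrefl dest: sym)
  qed
  have inj: "inj_on (insert v) (?ind ?T)"
  proof (rule inj_onI)
    fix I J assume "I \<in> ?ind ?T" "J \<in> ?ind ?T" and eq: "insert v I = insert v J"
    then have "v \<notin> I" "v \<notin> J" by auto
    then show "I = J" using eq by (simp add: insert_ident)
  qed
  have finT: "finite (?ind T)" if "T \<subseteq> S" for T
    using finite_subset[OF that fin] by (auto intro: finite_subset[of _ "Pow T"])
  have "Z S = (\<Sum>I \<in> ?ind (S - {v}). x ^ card I) + (\<Sum>I \<in> insert v ` ?ind ?T. x ^ card I)"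
    unfolding Z_def split
    by (intro sum.union_disjoint finite_imageI finT) auto
  also have "(\<Sum>I \<in> insert v ` ?ind ?T. x ^ card I) = (\<Sum>I \<in> ?ind ?T. x ^ card (insert v I))"
    by (simp add: sum.reindex[OF inj])
  also have "\<dots> = (\<Sum>I \<in> ?ind ?T. x * x ^ card I)"
  proof (rule sum.cong[OF refl])
    fix I assume "I \<in> ?ind ?T"
    then have "finite I" "v \<notin> I" using fin by (auto intro: finite_subset)
    then show "x ^ card (insert v I) = x * x ^ card I" by simp
  qed
  finally show ?thesis by (simp add: Z_def sum_distrib_left)
qed

lemma Z_eq_ratio:
  assumes "S \<subseteq> V" "v \<in> S" "Z (S - {v}) \<noteq> 0"
  shows "Z S = Z (S - {v}) * (1 + ratio S v)"
  using assms by (simp add: Z_rec[OF assms(1,2)] ratio_def field_simps)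

text \<open>Both claims go through one induction on S: the ratio formula divides by values at
  smaller sets, and nonvanishing at S needs the ratios there. Only vertices with at most d
  neighbours left are claimed to have ratios in U.\<close>

lemma Z_nonzero:
  assumes deg: "\<And>v. v \<in> V \<Longrightarrow> card (nbrs V v) \<le> d + 1"
    and step: "\<And>zs. length zs \<le> d \<Longrightarrow> set zs \<subseteq> U \<Longrightarrow> x / prod_list (map (\<lambda>z. 1 + z) zs) \<in> U"
    and root: "\<And>zs. length zs \<le> d + 1 \<Longrightarrow> set zs \<subseteq> U \<Longrightarrow> 1 + x / prod_list (map (\<lambda>z. 1 + z) zs) \<noteq> 0"
    and "S \<subseteq> V"
  shows "Z S \<noteq> 0 \<and> (\<forall>v\<in>S. card (nbrs S v) \<le> d \<longrightarrow> ratio S v \<in> U)"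
proof -
  have "finite S" using \<open>S \<subseteq> V\<close> finite_V finite_subset by blast
  from this \<open>S \<subseteq> V\<close> show ?thesis
  proof (induction S rule: finite_psubset_induct)
    case (psubset S)
    have finS: "finite S" by fact
    have nz: "Z T \<noteq> 0" if "T \<subset> S" for T
      using psubset.IH[OF that] psubset.prems that by auto
    have ratio_in: "ratio T u \<in> U" if "T \<subset> S" "u \<in> T" "card (nbrs T u) \<le> d" for T u
      using psubset.IH[OF that(1)] psubset.prems that by auto
    have ratio_eq: "\<exists>zs. length zs = card (nbrs S v) \<and> set zs \<subseteq> U \<and>
        ratio S v = x / prod_list (map (\<lambda>z. 1 + z) zs)" if v: "v \<in> S" for v
    proof -
      \<comment> \<open>The neighbours of v are deleted one by one, each contributing the factor 1
        plus its ratio at the time of deletion.\<close>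
      have telescope: "finite N \<Longrightarrow> N \<subseteq> nbrs S v \<Longrightarrow> \<exists>zs. length zs = card N \<and> set zs \<subseteq> U \<and>
          Z (S - {v}) = Z (S - {v} - N) * prod_list (map (\<lambda>z. 1 + z) zs)" for N
      proof (induction N rule: finite_induct)
        case empty
        then show ?case by simp
      next
        case (insert u N)
        then obtain zs where zs: "length zs = card N" "set zs \<subseteq> U"
          "Z (S - {v}) = Z (S - {v} - N) * prod_list (map (\<lambda>z. 1 + z) zs)"
          by auto
        let ?T = "S - {v} - N"
        have u: "u \<in> ?T" "u \<in> V" "adj u v" "?T \<subset> S" "?T \<subseteq> V"
          using insert.hyps insert.prems irrefl sym psubset.prems v by (auto simp: nbrs_def)
        \<comment> \<open>The vertex u has already lost its neighbour v, which lowers the degree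
          bound from d + 1 to d.\<close>
        have "insert v (nbrs ?T u) \<subseteq> nbrs V u"
          using u psubset.prems v by (auto simp: nbrs_def)
        moreover have "finite (nbrs V u)" using finite_V by (simp add: nbrs_def)
        ultimately have "card (insert v (nbrs ?T u)) \<le> d + 1"
          using deg[OF u(2)] card_mono le_trans by metis
        moreover have "card (insert v (nbrs ?T u)) = card (nbrs ?T u) + 1"
          using finS by (simp add: nbrs_def)
        ultimately have "ratio ?T u \<in> U" using ratio_in u by simp
        moreover have "Z ?T = Z (?T - {u}) * (1 + ratio ?T u)"
          using u by (intro Z_eq_ratio nz) auto
        moreover have "?T - {u} = S - {v} - insert u N" by auto
        ultimately show ?case
          using zs insert.hyps by (intro exI[of _ "ratio ?T u # zs"]) (simp add: mult.assoc)
      qed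
      have "finite (nbrs S v)" using finS by (simp add: nbrs_def)
      from telescope[OF this order_refl] obtain zs where zs: "length zs = card (nbrs S v)" "set zs \<subseteq> U"
        "Z (S - {v}) = Z (S - {v} - nbrs S v) * prod_list (map (\<lambda>z. 1 + z) zs)"
        by blast
      moreover have "Z (S - {v} - nbrs S v) \<noteq> 0" using v by (intro nz) auto
      ultimately have "ratio S v = x / prod_list (map (\<lambda>z. 1 + z) zs)"
        by (simp add: ratio_def)
      with zs show ?thesis by blast
    qed
    have "Z S \<noteq> 0"
    proof (cases "S = {}")
      case True
      then show ?thesis by (simp add: Z_empty)
    next
      case False
      then obtain v where v: "v \<in> S" by blast
      then have "card (nbrs S v) \<le> card (nbrs V v)"
        using psubset.prems finite_V by (intro card_mono) (auto simp: nbrs_def)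
      then have "card (nbrs S v) \<le> d + 1" using deg[of v] v psubset.prems by auto
      \<comment> \<open>Here v may still have d + 1 neighbours, so \<open>root\<close> is used in
        place of \<open>step\<close>.\<close>
      then have "1 + ratio S v \<noteq> 0" using ratio_eq[OF v] root by metis
      moreover have "Z (S - {v}) \<noteq> 0" using v by (intro nz) auto
      ultimately show ?thesis using Z_eq_ratio[OF psubset.prems v] by simp
    qed
    moreover have "ratio S v \<in> U" if "v \<in> S" "card (nbrs S v) \<le> d" for v
      using ratio_eq[OF that(1)] that(2) step by metis
    ultimately show ?case by blast
  qed
qed

end

section \<open>Transfer to graphs\<close>

lemma independence_poly_nonzero:
  assumes G: "G \<in> graphs_max_degree (d + 1)"
    and step: "\<And>zs. length zs \<le> d \<Longrightarrow> set zs \<subseteq> U \<Longrightarrow> x / prod_list (map (\<lambda>z. 1 + z) zs) \<in> U"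
    and root: "\<And>zs. length zs \<le> d + 1 \<Longrightarrow> set zs \<subseteq> U \<Longrightarrow> 1 + x / prod_list (map (\<lambda>z. 1 + z) zs) \<noteq> 0"
  shows "independence_poly G x \<noteq> 0"
proof -
  interpret graph G using G by (simp add: graphs_max_degree_def)
  have sym: "v \<rightarrow>\<^bsub>G\<^esub> u" if "u \<rightarrow>\<^bsub>G\<^esub> v" for u v
    using sym_arcs that unfolding symmetric_def by (rule symD)
  have irrefl: "\<not> v \<rightarrow>\<^bsub>G\<^esub> v" for v
    using no_loops by (auto simp: arcs_ends_conv)
  interpret finite_adjacency "verts G" "\<lambda>u v. u \<rightarrow>\<^bsub>G\<^esub> v" x
    by unfold_locales (simp, erule sym, rule irrefl)
  have "card (nbrs (verts G) v) \<le> d + 1" if "v \<in> verts G" for v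
  proof -
    \<comment> \<open>Each neighbour is the head of an arc leaving v, so the out-degree bounds the
      number of neighbours.\<close>
    have "nbrs (verts G) v \<subseteq> head G ` out_arcs G v"
      unfolding nbrs_def by (force simp: arcs_ends_conv out_arcs_def)
    then have "card (nbrs (verts G) v) \<le> card (out_arcs G v)"
      by (intro surj_card_le) auto
    also have "\<dots> \<le> d + 1"
      using G that by (simp add: graphs_max_degree_def out_degree_def)
    finally show ?thesis .
  qed
  from Z_nonzero[OF this step root order_refl] show ?thesis
    by (simp add: Z_def independence_poly_def independent_sets_def)
qed

theorem theorem4p5:
  fixes d :: nat and x :: complex and f :: "complex \<Rightarrow> complex"
    and h :: "real \<Rightarrow> complex" and a b :: real
    and G :: "('a, 'b) pre_digraph"
  assumes "d \<ge> 2"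
    and "f = (\<lambda>z. x / (1 + z) ^ d)"
    and "a < b"
    and "continuous_on {a..b} h"
    and "\<exists>t \<in> {a..b}. h t = 0"
    and "strict_mono_on {a..<b} (\<lambda>t. Arg (1 + h t))"
    and "\<And>t1 t2 \<alpha>. t1 \<in> {a..b} \<Longrightarrow> t2 \<in> {a..b} \<Longrightarrow> t1 \<le> t2 \<Longrightarrow> \<alpha> \<in> {0..1} \<Longrightarrow>
           \<exists>t \<in> {t1..t2}. minus_one_covered (of_real \<alpha> * h t1 + of_real (1 - \<alpha>) * h t2) (h t)"
    and "\<And>t. t \<in> {a..b} \<Longrightarrow> \<exists>t' \<in> {a..b}. minus_one_covered (f (h t)) (h t')"
    and "G \<in> graphs_max_degree (d + 1)"
  shows "independence_poly G x \<noteq> 0"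
proof -
  interpret covering_curve h a b
    using assms(3-7) by unfold_locales
  have inv: "\<exists>t' \<in> {a..b}. minus_one_covered (x / (1 + h t) ^ d) (h t')" if "t \<in> {a..b}" for t
    using assms(8)[OF that] assms(2) by simp
  have "d > 0" using assms(1) by simp
  \<comment> \<open>The invariant set U is the region covered by the curve.\<close>
  from independence_poly_nonzero[OF assms(9)
      region_step[OF this inv] region_root_nonzero[OF this inv]]
  show ?thesis .
qed

end
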